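(* Let $(X,+)$ be a commutative semigroup, $\vec k=(k_n)_{n\in\mathbb N}\subseteq\mathbb N$ an increasing sequence and, for every $l\in\mathbb N$, $(y_{l,n})_{n\in\mathbb N}$ a sequence in $X$. If $\mathcal U\subseteq X^{\mathbb N}$ is pointwise closed, then there exist sequences $(E_n)_{n\in\mathbb N}$ and $(H_n)_{n\in\mathbb N}$ of non-empty finite subsets of $\mathbb N$ with $\max E_n<\min E_{n+1}$ and $H_n\subseteq E_n$ for every $n$, and a sequence $(\beta_n)_{n\in\mathbb N}\subseteq X$ with $\beta_n=\sum_{j\in E_n\setminus H_n}y_{l^n_j,j}$ for some integers $1\le l^n_j\le k_j$, such that for every function $f:\mathbb N\to\mathbb N$ with $f(n)\le k_n$ for every $n$, either $\big[FS\big((\beta_n+\sum_{t\in H_n}y_{f(n),t})_{n\in\mathbb N}\big)\big]^\omega\subseteq\mathcal U$, or $\big[FS\big((\beta_n+\sum_{t\in H_n}y_{f(n),t})_{n\in\mathbb N}\big)\big]^\omega\subseteq X^{\mathbb N}\setminus\mathcal U$.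
   Context: $\mathbb N=\{1,2,\dots\}$. $X^{\mathbb N}$ carries the product topology (topology of pointwise convergence, $X$ discrete); pointwise closed means closed in it. For a sequence $(x_n)$ in $X$, $FS((x_n))=\{x_{n_1}+\dots+x_{n_\lambda}:\lambda\in\mathbb N,\ n_1<\dots<n_\lambda\}$; for $y=x_{n_1}+\dots+x_{n_\lambda}$ and $z=x_{m_1}+\dots+x_{m_\nu}$ in $FS((x_n))$ (with increasing indices) write $y<z$ if $n_\lambda<m_1$; $[FS((x_n))]^\omega=\{(y_n)_{n\in\mathbb N}:y_n\in FS((x_n)),\ y_n<y_{n+1}\ \forall n\}$. *)

theory Defs
  imports "HOL-Analysis.Function_Topology"
begin

text \<open>The sum of a family over a non-empty finite index set in a commutative semigroup, which
  need not have a neutral element (so \<open>sum\<close>, which needs one, does not apply). On the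
  empty set the value is meaningless.\<close>

definition semigroup_sum :: "(nat \<Rightarrow> 'a::ab_semigroup_add) \<Rightarrow> nat set \<Rightarrow> 'a" where
  "semigroup_sum x F = Finite_Set.fold (\<lambda>n s. x n + s) (x (Min F)) (F - {Min F})"

lemma semigroup_sum_singleton: "semigroup_sum x {n} = x n"
  by (simp add: semigroup_sum_def)

lemma semigroup_sum_insert:
  assumes "finite F" "F \<noteq> {}" "n \<notin> F"
  shows "semigroup_sum x (insert n F) = x n + semigroup_sum x F"
proof -
  interpret comp_fun_commute "\<lambda>n s. x n + s"
    by standard (auto simp: fun_eq_iff ac_simps)
  have swap: "x a + Finite_Set.fold (\<lambda>n s. x n + s) (x b) A
      = x b + Finite_Set.fold (\<lambda>n s. x n + s) (x a) A" if "finite A" for a b A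
    using that
  proof (induction A rule: finite_induct)
    case (insert c A)
    then have "Finite_Set.fold (\<lambda>n s. x n + s) z (insert c A)
        = x c + Finite_Set.fold (\<lambda>n s. x n + s) z A" for z
      by (subst fold_insert) auto
    then show ?case using insert.IH by (metis add.left_commute)
  qed (simp add: add.commute)
  show ?thesis
  proof (cases "n < Min F")
    case True
    then have "Min (insert n F) = n" using assms by (subst Min_insert) (auto intro: min_absorb1)
    then have "semigroup_sum x (insert n F) = Finite_Set.fold (\<lambda>n s. x n + s) (x n) F"
      using assms by (simp add: semigroup_sum_def)
    also have "\<dots> = Finite_Set.fold (\<lambda>n s. x n + s) (x n) (insert (Min F) (F - {Min F}))"
      using assms by (simp add: insert_absorb)
    also have "\<dots> = x (Min F) + Finite_Set.fold (\<lambda>n s. x n + s) (x n) (F - {Min F})"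
      using assms by (subst fold_insert) auto
    finally show ?thesis using swap assms by (simp add: semigroup_sum_def)
  next
    case False
    then have "Min (insert n F) = Min F" using Min_insert[of F n] assms by linarith
    moreover have "n \<noteq> Min F" using assms Min_in by metis
    then have "insert n F - {Min F} = insert n (F - {Min F})" by auto
    ultimately show ?thesis using assms by (simp add: semigroup_sum_def)
  qed
qed

definition block_sequence :: "(nat \<Rightarrow> nat set) \<Rightarrow> bool" where
  "block_sequence E \<longleftrightarrow>
     (\<forall>n. finite (E n) \<and> E n \<noteq> {} \<and> Max (E n) < Min (E (Suc n)))"

definition FS :: "(nat \<Rightarrow> 'a::ab_semigroup_add) \<Rightarrow> 'a set" where
  "FS x = {semigroup_sum x F | F. finite F \<and> F \<noteq> {}}"

text \<open>\<open>[FS x]\<^sup>\<omega>\<close>: sequences \<open>y 0 < y 1 < \<dots>\<close> in \<open>FS x\<close>. The relation \<open>y < z\<close> compares the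
  index sets of \<open>y\<close> and \<open>z\<close>, which an element of \<open>FS x\<close> need not determine; here each term
  comes with one index set, used for the comparison with both of its neighbours.\<close>

definition FS_omega :: "(nat \<Rightarrow> 'a::ab_semigroup_add) \<Rightarrow> (nat \<Rightarrow> 'a) set" where
  "FS_omega x = {y. \<exists>F. block_sequence F \<and> (\<forall>n. y n = semigroup_sum x (F n))}"

lemma FS_omega_in_FS: "y \<in> FS_omega x \<Longrightarrow> y n \<in> FS x"
  by (auto simp: FS_omega_def FS_def block_sequence_def)

abbreviation pointwise_topology :: "(nat \<Rightarrow> 'a) topology" where
  "pointwise_topology \<equiv> product_topology (\<lambda>_. discrete_topology UNIV) UNIV"

end

theory Submission imports Defs begin

text \<open>Encode the sums \<open>\<Sum>j. y (l j) j\<close> by located words, finite partial maps from positions to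
  letters, with an additional letter for the variable. The ultrafilters on located words all of
  whose members contain arbitrarily late instances of a variable word form a closed semigroup,
  which is non-empty by the Hales--Jewett theorem; hence some such ultrafilter \<open>p\<close> is idempotent.
  Since the complement of \<open>U\<close> is open, membership in \<open>U\<close> is decided along some tree of finite
  sequences of words that branches \<open>p\<close>-often at every node. Idempotence of \<open>p\<close> gives, as in the
  Galvin--Glazer proof of Hindman's theorem, a sequence of variable words all of whose block
  sequences of instances are branches of this tree.\<close>

section \<open>Ultrafilters\<close>

definition ultrafilter :: "'a set set \<Rightarrow> bool" where
  "ultrafilter p \<longleftrightarrow> {} \<notin> p \<and> (\<forall>A B. A \<in> p \<longrightarrow> A \<subseteq> B \<longrightarrow> B \<in> p)
     \<and> (\<forall>A B. A \<in> p \<longrightarrow> B \<in> p \<longrightarrow> A \<inter> B \<in> p) \<and> (\<forall>A. A \<in> p \<or> - A \<in> p)"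

lemma ultrafilter_mono: "ultrafilter p \<Longrightarrow> A \<in> p \<Longrightarrow> A \<subseteq> B \<Longrightarrow> B \<in> p"
  by (auto simp: ultrafilter_def)

lemma ultrafilter_Int: "ultrafilter p \<Longrightarrow> A \<inter> B \<in> p \<longleftrightarrow> A \<in> p \<and> B \<in> p"
  unfolding ultrafilter_def by (metis inf_le1 inf_le2)

lemma ultrafilter_Compl: "ultrafilter p \<Longrightarrow> - A \<in> p \<longleftrightarrow> A \<notin> p"
  unfolding ultrafilter_def by (metis Compl_disjoint)

lemma ultrafilter_UNIV: "ultrafilter p \<Longrightarrow> UNIV \<in> p"
  unfolding ultrafilter_def by (metis subset_UNIV)

lemma ultrafilter_Inter:
  "ultrafilter p \<Longrightarrow> finite F \<Longrightarrow> (\<And>i. i \<in> F \<Longrightarrow> A i \<in> p) \<Longrightarrow> (\<Inter>i\<in>F. A i) \<in> p"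
  by (rotate_tac, induction F rule: finite_induct) (auto simp: ultrafilter_UNIV ultrafilter_Int)

lemma ultrafilter_nonempty: "ultrafilter p \<Longrightarrow> A \<in> p \<Longrightarrow> \<exists>x. x \<in> A"
  unfolding ultrafilter_def by (metis equals0I)

lemma ultrafilter_eqI: "ultrafilter p \<Longrightarrow> ultrafilter q \<Longrightarrow> p \<subseteq> q \<Longrightarrow> p = q"
  using ultrafilter_Compl by blast

text \<open>By Zorn's lemma \<open>F\<close> lies in a maximal family with the finite intersection
  property; maximality makes this family an ultrafilter.\<close>

lemma ultrafilter_ex:
  assumes fip: "\<And>H. finite H \<Longrightarrow> H \<subseteq> F \<Longrightarrow> \<Inter>H \<noteq> {}"
  shows "\<exists>p. ultrafilter p \<and> F \<subseteq> p"
proof -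
  define S where "S = {G. F \<subseteq> G \<and> (\<forall>H. finite H \<longrightarrow> H \<subseteq> G \<longrightarrow> \<Inter>H \<noteq> {})}"
  have "\<exists>M\<in>S. \<forall>X\<in>S. M \<subseteq> X \<longrightarrow> X = M"
  proof (rule subset_Zorn_nonempty)
    show "S \<noteq> {}" using fip by (auto simp: S_def)
    fix C assume C: "C \<noteq> {}" "subset.chain S C"
    have "\<Inter>H \<noteq> {}" if H: "finite H" "H \<subseteq> \<Union>C" for H
    proof -
      obtain B where "B \<in> C" "H \<subseteq> B" using finite_subset_Union_chain[OF H C] by blast
      then show ?thesis using C H by (auto simp: S_def subset.chain_def)
    qed
    moreover have "F \<subseteq> \<Union>C" using C by (fastforce simp: S_def subset.chain_def)
    ultimately show "\<Union>C \<in> S" by (simp add: S_def)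
  qed
  then obtain M where M: "M \<in> S" and max: "\<And>X. X \<in> S \<Longrightarrow> M \<subseteq> X \<Longrightarrow> X = M" by blast
  have FM: "F \<subseteq> M" and Mfip: "\<And>H. finite H \<Longrightarrow> H \<subseteq> M \<Longrightarrow> \<Inter>H \<noteq> {}"
    using M by (auto simp: S_def)
  have sep: "\<exists>H. finite H \<and> H \<subseteq> M \<and> \<Inter>H \<inter> A = {}" if "A \<notin> M" for A
  proof (rule ccontr)
    assume no: "\<not> ?thesis"
    have "insert A M \<in> S"
      unfolding S_def
    proof (intro CollectI conjI allI impI)
      show "F \<subseteq> insert A M" using FM by blast
      fix H assume H: "finite H" "H \<subseteq> insert A M"
      then have "finite (H - {A})" "H - {A} \<subseteq> M" by auto
      then have "\<Inter>(H - {A}) \<inter> A \<noteq> {}" using no[unfolded not_ex, rule_format, of "H - {A}"] by simp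
      moreover have "\<Inter>(H - {A}) \<inter> A \<subseteq> \<Inter>H" by blast
      ultimately show "\<Inter>H \<noteq> {}" by blast
    qed
    then show False using max that by blast
  qed
  have up: "B \<in> M" if "finite H" "H \<subseteq> M" "\<Inter>H \<subseteq> B" for H B
  proof (rule ccontr)
    assume "B \<notin> M"
    then obtain K where K: "finite K" "K \<subseteq> M" "\<Inter>K \<inter> B = {}" using sep[of B] by auto
    then have "\<Inter>(H \<union> K) = {}" unfolding Inter_Un_distrib using that(3) K(3) by blast
    moreover have "finite (H \<union> K)" "H \<union> K \<subseteq> M" using that K by simp_all
    ultimately show False using Mfip[of "H \<union> K"] by simp
  qed
  have "{} \<notin> M" using Mfip[of "{{}}"] by auto
  moreover have "B \<in> M" if "A \<in> M" "A \<subseteq> B" for A B using up[of "{A}" B] that by auto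
  moreover have "A \<inter> B \<in> M" if "A \<in> M" "B \<in> M" for A B using up[of "{A, B}"] that by auto
  moreover have "A \<in> M \<or> - A \<in> M" for A
  proof (rule ccontr)
    assume no: "\<not> ?thesis"
    obtain K where K: "finite K" "K \<subseteq> M" "\<Inter>K \<inter> A = {}" using sep[of A] no by auto
    then show False using no up[of K "- A"] by blast
  qed
  ultimately show ?thesis using FM unfolding ultrafilter_def by blast
qed

text \<open>The image ultrafilter, that is, the extension of \<open>f\<close> to the Stone-Cech
  compactifications.\<close>

definition ultramap :: "('a \<Rightarrow> 'b) \<Rightarrow> 'a set set \<Rightarrow> 'b set set" where
  "ultramap f p = {A. f -` A \<in> p}"

lemma mem_ultramap: "A \<in> ultramap f p \<longleftrightarrow> {x. f x \<in> A} \<in> p"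
  by (simp add: ultramap_def vimage_def)

lemma ultrafilter_ultramap: "ultrafilter p \<Longrightarrow> ultrafilter (ultramap f p)"
  unfolding ultramap_def ultrafilter_def mem_Collect_eq vimage_empty vimage_Int vimage_Compl
  by (metis vimage_mono)

lemma ultrafilter_iff:
  "ultrafilter p \<Longrightarrow> {x. P x \<longleftrightarrow> Q x} \<in> p \<longleftrightarrow> ({x. P x} \<in> p \<longleftrightarrow> {x. Q x} \<in> p)"
proof -
  assume p: "ultrafilter p"
  have "{x. P x \<longleftrightarrow> Q x} = - ({x. P x} \<inter> - {x. Q x}) \<inter> - (- {x. P x} \<inter> {x. Q x})" by auto
  then show ?thesis
    unfolding \<open>{x. P x \<longleftrightarrow> Q x} = _\<close> ultrafilter_Int[OF p] ultrafilter_Compl[OF p] by blast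
qed

lemma ultrafilter_ball:
  assumes "ultrafilter p" "finite F"
  shows "{x. \<forall>a\<in>F. P a x} \<in> p \<longleftrightarrow> (\<forall>a\<in>F. {x. P a x} \<in> p)"
proof -
  have "{x. \<forall>a\<in>F. P a x} = (\<Inter>a\<in>F. {x. P a x})" by auto
  then show ?thesis
    using ultrafilter_Inter[OF assms, of "\<lambda>a. {x. P a x}"] ultrafilter_mono[OF assms(1)]
    by (metis (no_types, lifting) INF_lower)
qed

text \<open>Every closed set of the Stone space has this form. Larger families give smaller closed
  sets, so minimal closed sets come from maximal families.\<close>

definition Stone_closed :: "'a set set \<Rightarrow> 'a set set set" where
  "Stone_closed G = {p. ultrafilter p \<and> G \<subseteq> p}"

text \<open>Compactness of the Stone space.\<close>

lemma Stone_closed_nonempty_iff: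
  "Stone_closed G \<noteq> {} \<longleftrightarrow> (\<forall>H. finite H \<longrightarrow> H \<subseteq> G \<longrightarrow> \<Inter>H \<noteq> {})"
proof
  assume "Stone_closed G \<noteq> {}"
  then obtain p where p: "ultrafilter p" "G \<subseteq> p" by (auto simp: Stone_closed_def)
  show "\<forall>H. finite H \<longrightarrow> H \<subseteq> G \<longrightarrow> \<Inter>H \<noteq> {}"
    using ultrafilter_Inter[OF p(1), of _ id] ultrafilter_nonempty[OF p(1)] p(2)
    by (metis empty_iff id_apply image_id subsetD)
qed (use ultrafilter_ex[of G] in \<open>auto simp: Stone_closed_def\<close>)

section \<open>Products of ultrafilters\<close>

context semigroup
begin

text \<open>The product of the Stone-Cech compactification, in the convention that makes it
  continuous in \<open>p\<close> for fixed \<open>q\<close>.\<close>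

definition ultraprod :: "'a set set \<Rightarrow> 'a set set \<Rightarrow> 'a set set" where
  "ultraprod p q = {A. {x. {y. x \<^bold>* y \<in> A} \<in> q} \<in> p}"

lemma mem_ultraprod: "A \<in> ultraprod p q \<longleftrightarrow> {x. {y. x \<^bold>* y \<in> A} \<in> q} \<in> p"
  by (simp add: ultraprod_def)

lemma ultraprod_ultrafilter:
  assumes p: "ultrafilter p" and q: "ultrafilter q"
  shows "ultrafilter (ultraprod p q)"
proof -
  have int: "{y. x \<^bold>* y \<in> A \<inter> B} = {y. x \<^bold>* y \<in> A} \<inter> {y. x \<^bold>* y \<in> B}" for x A B by auto
  have cmp: "{y. x \<^bold>* y \<in> - A} = - {y. x \<^bold>* y \<in> A}" for x A by auto
  have "A \<inter> B \<in> ultraprod p q \<longleftrightarrow> A \<in> ultraprod p q \<and> B \<in> ultraprod p q" for A B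
    unfolding mem_ultraprod int ultrafilter_Int[OF q] Collect_conj_eq ultrafilter_Int[OF p] ..
  moreover have "- A \<in> ultraprod p q \<longleftrightarrow> A \<notin> ultraprod p q" for A
    unfolding mem_ultraprod cmp ultrafilter_Compl[OF q] Collect_neg_eq ultrafilter_Compl[OF p] ..
  moreover have "{} \<notin> ultraprod p q"
    using p q by (simp add: mem_ultraprod ultrafilter_def)
  ultimately show ?thesis
    unfolding ultrafilter_def inf.absorb_iff1 by metis
qed

lemma ultraprod_assoc: "ultraprod (ultraprod p q) r = ultraprod p (ultraprod q r)"
  by (simp add: ultraprod_def assoc)

lemma ultraprodI:
  assumes "ultrafilter p" "ultrafilter q" "A \<in> p" "\<And>x. x \<in> A \<Longrightarrow> B x \<in> q"
    and "\<And>x y. x \<in> A \<Longrightarrow> y \<in> B x \<Longrightarrow> x \<^bold>* y \<in> C"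
  shows "C \<in> ultraprod p q"
proof -
  have "{y. x \<^bold>* y \<in> C} \<in> q" if "x \<in> A" for x
    by (rule ultrafilter_mono[OF assms(2) assms(4)[OF that]]) (use assms(5)[OF that] in blast)
  then have "A \<subseteq> {x. {y. x \<^bold>* y \<in> C} \<in> q}" by blast
  then show ?thesis
    unfolding mem_ultraprod by (rule ultrafilter_mono[OF assms(1,3)])
qed

text \<open>The Ellis--Numakura lemma. If \<open>K\<close> is a minimal closed subsemigroup and
  \<open>p\<close> lies in \<open>K\<close>, then \<open>K p\<close> is a closed subsemigroup, so it
  equals \<open>K\<close>. Hence the \<open>q\<close> in \<open>K\<close> with
  \<open>q p = p\<close> form a non-empty closed subsemigroup, which is again \<open>K\<close> and
  so contains \<open>p\<close>.\<close>

lemma Stone_closed_idempotent: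
  assumes ne: "Stone_closed G \<noteq> {}"
    and sub: "\<And>p q. p \<in> Stone_closed G \<Longrightarrow> q \<in> Stone_closed G \<Longrightarrow> ultraprod p q \<in> Stone_closed G"
  shows "\<exists>p\<in>Stone_closed G. ultraprod p p = p"
proof -
  define S where "S = {F. G \<subseteq> F \<and> Stone_closed F \<noteq> {}
    \<and> (\<forall>p\<in>Stone_closed F. \<forall>q\<in>Stone_closed F. ultraprod p q \<in> Stone_closed F)}"
  have "\<exists>M\<in>S. \<forall>X\<in>S. M \<subseteq> X \<longrightarrow> X = M"
  proof (rule subset_Zorn_nonempty)
    show "S \<noteq> {}" using ne sub by (auto simp: S_def)
    fix C assume C: "C \<noteq> {}" "subset.chain S C"
    then have CS: "C \<subseteq> S" by (simp add: subset.chain_def)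
    have "Stone_closed (\<Union>C) \<noteq> {}"
      unfolding Stone_closed_nonempty_iff
    proof (intro allI impI)
      fix H assume H: "finite H" "H \<subseteq> \<Union>C"
      obtain B where B: "B \<in> C" "H \<subseteq> B" using finite_subset_Union_chain[OF H C] by blast
      then have "Stone_closed B \<noteq> {}" using CS by (auto simp: S_def)
      then show "\<Inter>H \<noteq> {}" unfolding Stone_closed_nonempty_iff using H(1) B(2) by blast
    qed
    moreover have "G \<subseteq> \<Union>C" using C(1) CS by (fastforce simp: S_def)
    moreover have "ultraprod p q \<in> Stone_closed (\<Union>C)"
      if "p \<in> Stone_closed (\<Union>C)" "q \<in> Stone_closed (\<Union>C)" for p q
    proof -
      have "ultraprod p q \<in> Stone_closed B" if "B \<in> C" for B
      proof -
        have "p \<in> Stone_closed B" "q \<in> Stone_closed B"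
          using that \<open>p \<in> _\<close> \<open>q \<in> _\<close> by (auto simp: Stone_closed_def)
        then show ?thesis using CS that by (auto simp: S_def)
      qed
      then show ?thesis using C(1) by (auto simp: Stone_closed_def)
    qed
    ultimately show "\<Union>C \<in> S" by (simp add: S_def)
  qed
  then obtain M where M: "M \<in> S" and max: "\<And>X. X \<in> S \<Longrightarrow> M \<subseteq> X \<Longrightarrow> X = M" by blast
  let ?K = "Stone_closed M"
  have GM: "G \<subseteq> M" and Mp: "\<And>p q. p \<in> ?K \<Longrightarrow> q \<in> ?K \<Longrightarrow> ultraprod p q \<in> ?K"
    using M by (auto simp: S_def)
  obtain p where p: "p \<in> ?K" using M by (auto simp: S_def)
  then have up: "ultrafilter p" by (simp add: Stone_closed_def)
  \<comment> \<open>\<open>Stone_closed F\<close> is the closure of \<open>K p\<close>; compactness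
    will show that \<open>K p\<close> is already closed.\<close>
  define F where "F = {A. \<forall>q\<in>?K. A \<in> ultraprod q p}"
  have MF: "M \<subseteq> F" using Mp[OF _ p] by (auto simp: F_def Stone_closed_def)
  have image: "\<exists>q\<in>?K. r = ultraprod q p" if r: "r \<in> Stone_closed F" for r
  proof -
    have ur: "ultrafilter r" and Fr: "F \<subseteq> r" using r by (auto simp: Stone_closed_def)
    let ?s = "\<lambda>A. {x. {y. x \<^bold>* y \<in> A} \<in> p}"
    \<comment> \<open>A set \<open>?s A\<close> belongs to \<open>q\<close> exactly when
      \<open>A\<close> belongs to \<open>ultraprod q p\<close>, so \<open>q\<close> has to contain
      these sets for all \<open>A\<close> in \<open>r\<close>.\<close>
    have "Stone_closed (M \<union> ?s ` r) \<noteq> {}"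
      unfolding Stone_closed_nonempty_iff
    proof (intro allI impI notI)
      fix H assume H: "finite H" "H \<subseteq> M \<union> ?s ` r" "\<Inter>H = {}"
      obtain R where R: "R \<subseteq> r" "finite R" "H - M = ?s ` R"
        using finite_subset_image[of "H - M" ?s r] H by blast
      define A where "A = \<Inter>R"
      have Ar: "A \<in> r" using ultrafilter_Inter[OF ur R(2), of id] R(1) by (auto simp: A_def)
      \<comment> \<open>Otherwise \<open>q\<close> would contain all of \<open>H\<close>, whose
        intersection is empty. Hence \<open>- A\<close> is in \<open>F\<close> and so in
        \<open>r\<close>, which contains \<open>A\<close>.\<close>
      have "A \<notin> ultraprod q p" if q: "q \<in> ?K" for q
      proof
        assume A: "A \<in> ultraprod q p"
        have uq: "ultrafilter q" and Mq: "M \<subseteq> q" using q by (auto simp: Stone_closed_def)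
        have "B \<in> q" if "B \<in> H" for B
        proof (cases "B \<in> M")
          case False
          then have "B \<in> ?s ` R" using that by (simp flip: R(3))
          then obtain A' where A': "A' \<in> R" "B = ?s A'" by (elim imageE)
          have "A \<subseteq> A'" using A' by (auto simp: A_def)
          then have "A' \<in> ultraprod q p"
            using A ultraprod_ultrafilter[OF uq up] ultrafilter_mono by blast
          then show ?thesis using A' by (simp add: mem_ultraprod)
        qed (use Mq in auto)
        then have "\<Inter>H \<in> q" using ultrafilter_Inter[OF uq H(1), of id] by simp
        then show False using uq H(3) by (simp add: ultrafilter_def)
      qed
      then have "- A \<in> F"
        using ultraprod_ultrafilter[OF _ up] ultrafilter_Compl
        by (fastforce simp: F_def Stone_closed_def)
      then show False using Fr Ar ultrafilter_Compl[OF ur] by blast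
    qed
    then obtain q where q: "ultrafilter q" "M \<subseteq> q" "?s ` r \<subseteq> q" by (auto simp: Stone_closed_def)
    then have "r \<subseteq> ultraprod q p" by (auto simp: mem_ultraprod image_subset_iff)
    then have "r = ultraprod q p"
      using ultrafilter_eqI ur ultraprod_ultrafilter[OF q(1) up] by blast
    then show ?thesis using q by (auto simp: Stone_closed_def)
  qed
  have img: "ultraprod q p \<in> Stone_closed F" if "q \<in> ?K" for q
    using that up ultraprod_ultrafilter by (auto simp: F_def Stone_closed_def)
  have "F \<in> S"
    unfolding S_def
  proof (intro CollectI conjI ballI)
    show "G \<subseteq> F" using GM MF by blast
    show "Stone_closed F \<noteq> {}" using img p by blast
    fix r s assume "r \<in> Stone_closed F" "s \<in> Stone_closed F"
    then obtain q q' where "q \<in> ?K" "q' \<in> ?K" "r = ultraprod q p" "s = ultraprod q' p"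
      using image by metis
    then show "ultraprod r s \<in> Stone_closed F"
      using img[of "ultraprod (ultraprod q p) q'"] p Mp by (simp add: ultraprod_assoc)
  qed
  then have "F = M" using max MF by blast
  then obtain q where q: "q \<in> ?K" "ultraprod q p = p" using image[of p] p by metis
  define F' where "F' = M \<union> (\<lambda>A. {x. {y. x \<^bold>* y \<in> A} \<in> p}) ` p"
  have F': "r \<in> Stone_closed F' \<longleftrightarrow> r \<in> ?K \<and> ultraprod r p = p" for r
  proof -
    have "r \<in> Stone_closed F' \<longleftrightarrow> r \<in> ?K \<and> p \<subseteq> ultraprod r p"
      by (auto simp: Stone_closed_def F'_def mem_ultraprod image_subset_iff)
    then show ?thesis
      using ultrafilter_eqI[OF up] ultraprod_ultrafilter[OF _ up]
      by (auto simp: Stone_closed_def)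
  qed
  have "F' \<in> S"
    unfolding S_def
  proof (intro CollectI conjI ballI)
    show "G \<subseteq> F'" using GM by (auto simp: F'_def)
    show "Stone_closed F' \<noteq> {}" using F' q by blast
    fix r s assume "r \<in> Stone_closed F'" "s \<in> Stone_closed F'"
    then show "ultraprod r s \<in> Stone_closed F'"
      using Mp by (simp add: F' ultraprod_assoc)
  qed
  then have "F' = M" using max by (auto simp: F'_def)
  then have "ultraprod p p = p" using F' p by metis
  moreover have "p \<in> Stone_closed G" using p GM by (auto simp: Stone_closed_def)
  ultimately show ?thesis by blast
qed

primrec ultrapower :: "'a set set \<Rightarrow> nat \<Rightarrow> 'a set set" where
  "ultrapower p 0 = p"
| "ultrapower p (Suc n) = ultraprod p (ultrapower p n)"

text \<open>The exponent is shifted by one, as there need be no neutral element.\<close>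

lemma ultrapower_add:
  "ultrapower p (m + Suc n) = ultraprod (ultrapower p m) (ultrapower p n)"
  by (induction m) (auto simp: ultraprod_assoc)

lemma ultramap_ultraprod:
  assumes "\<And>x y. h (x \<^bold>* y) = h x \<^bold>* h y"
  shows "ultramap h (ultraprod p q) = ultraprod (ultramap h p) (ultramap h q)"
  by (auto simp: mem_ultramap mem_ultraprod assms)

lemma ultramap_ultrapower:
  assumes "\<And>x y. h (x \<^bold>* y) = h x \<^bold>* h y"
  shows "ultramap h (ultrapower p n) = ultrapower (ultramap h p) n"
  by (induction n) (auto simp: ultramap_ultraprod[of h, OF assms])

text \<open>The star set of the Galvin--Glazer argument: for an idempotent \<open>p\<close> it is as
  large as \<open>A\<close>, and almost all continuations of its points stay in it.\<close>

definition ultrastar :: "'a set set \<Rightarrow> 'a set \<Rightarrow> 'a set" where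
  "ultrastar p A = {x \<in> A. {y. x \<^bold>* y \<in> A} \<in> p}"

lemma ultrastar_mem:
  assumes "ultrafilter p" "ultraprod p p = p" "A \<in> p"
  shows "ultrastar p A \<in> p"
proof -
  have "A \<inter> {x. {y. x \<^bold>* y \<in> A} \<in> p} \<in> p"
    using assms by (metis mem_ultraprod ultrafilter_Int)
  moreover have "A \<inter> {x. {y. x \<^bold>* y \<in> A} \<in> p} = ultrastar p A" by (auto simp: ultrastar_def)
  ultimately show ?thesis by simp
qed

text \<open>\<open>ultrastar_mem\<close> applies to the set of those \<open>y\<close> that continue
  \<open>x\<close> inside \<open>A\<close>; by associativity the star set of this shift lies in the
  shift of the star set.\<close>

lemma ultrastar_shift:
  assumes "ultrafilter p" "ultraprod p p = p" "x \<in> ultrastar p A"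
  shows "{y. x \<^bold>* y \<in> ultrastar p A} \<in> p"
proof -
  have "ultrastar p {y. x \<^bold>* y \<in> A} \<in> p"
    using assms by (intro ultrastar_mem) (auto simp: ultrastar_def)
  moreover have "ultrastar p {y. x \<^bold>* y \<in> A} \<subseteq> {y. x \<^bold>* y \<in> ultrastar p A}"
    by (auto simp: ultrastar_def assoc)
  ultimately show ?thesis by (rule ultrafilter_mono[OF assms(1)])
qed

end

section \<open>Trees along an ultrafilter\<close>

text \<open>\<open>T\<close> is a set of nodes that may fail to be closed under prefixes; its
  branches are the sequences with all prefixes in \<open>T\<close>.\<close>

definition ultratree :: "'a set set \<Rightarrow> 'a list set \<Rightarrow> bool" where
  "ultratree p T \<longleftrightarrow> [] \<in> T \<and> (\<forall>s\<in>T. {x. s @ [x] \<in> T} \<in> p)"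

definition prefix_of :: "(nat \<Rightarrow> 'a) \<Rightarrow> nat \<Rightarrow> 'a list" where
  "prefix_of b n = map b [0..<n]"

lemma prefix_of_0: "prefix_of b 0 = []"
  by (simp add: prefix_of_def)

lemma prefix_of_Suc: "prefix_of b (Suc n) = prefix_of b n @ [b n]"
  by (simp add: prefix_of_def)

lemma prefix_of_Suc': "prefix_of b (Suc n) = b 0 # prefix_of (\<lambda>i. b (Suc i)) n"
  by (induction n) (auto simp: prefix_of_def)

text \<open>Determinacy of an open game. Let \<open>G\<close> consist of the \<open>s\<close> above
  which some tree has only branches that meet \<open>D\<close>. Trees above \<open>p\<close>-many
  successors of \<open>s\<close> can be glued to one above \<open>s\<close>, so if \<open>[]\<close>
  is not in \<open>G\<close>, then \<open>- G\<close> is a tree; it avoids \<open>D\<close> because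
  \<open>D\<close> lies in \<open>G\<close>.\<close>

lemma ultratree_dichotomy:
  assumes p: "ultrafilter p"
  shows "\<exists>T. ultratree p T \<and> (T \<inter> D = {} \<or>
    (\<forall>b. (\<forall>n. prefix_of b n \<in> T) \<longrightarrow> (\<exists>n. prefix_of b n \<in> D)))"
proof -
  define good where "good s T \<longleftrightarrow> ultratree p T \<and>
    (\<forall>b. (\<forall>n. prefix_of b n \<in> T) \<longrightarrow> (\<exists>n. s @ prefix_of b n \<in> D))" for s T
  define G where "G = {s. \<exists>T. good s T}"
  have DG: "s \<in> G" if "s \<in> D" for s
  proof -
    have "good s UNIV" using that ultrafilter_UNIV[OF p] prefix_of_0
      unfolding good_def ultratree_def by (metis append_Nil2 UNIV_I UNIV_eq_I mem_Collect_eq)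
    then show ?thesis by (auto simp: G_def)
  qed
  have step: "s \<in> G" if B: "{x. s @ [x] \<in> G} \<in> p" for s
  proof -
    obtain T where T: "\<And>x. s @ [x] \<in> G \<Longrightarrow> good (s @ [x]) (T x)" unfolding G_def
      using choice[of "\<lambda>x T. Ex (good (s @ [x])) \<longrightarrow> good (s @ [x]) T"] by blast
    define T' where "T' = insert [] {x # t | x t. s @ [x] \<in> G \<and> t \<in> T x}"
    have "{x. u @ [x] \<in> T'} \<in> p" if u: "u \<in> T'" for u
    proof (cases u)
      case Nil
      have "{x. s @ [x] \<in> G} \<subseteq> {x. u @ [x] \<in> T'}"
        using T Nil by (auto simp: T'_def good_def ultratree_def)
      then show ?thesis using ultrafilter_mono[OF p B] by blast
    next
      case (Cons x t)
      then have xt: "s @ [x] \<in> G" "t \<in> T x" using u by (auto simp: T'_def)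
      then have "{z. t @ [z] \<in> T x} \<in> p" using T by (auto simp: good_def ultratree_def)
      moreover have "{z. t @ [z] \<in> T x} \<subseteq> {z. u @ [z] \<in> T'}" using xt Cons by (auto simp: T'_def)
      ultimately show ?thesis using ultrafilter_mono[OF p] by blast
    qed
    then have "ultratree p T'" by (auto simp: ultratree_def T'_def)
    moreover have "\<exists>n. s @ prefix_of b n \<in> D" if b: "\<And>n. prefix_of b n \<in> T'" for b
    proof -
      have x: "s @ [b 0] \<in> G" and "prefix_of (\<lambda>i. b (Suc i)) n \<in> T (b 0)" for n
        using b[of "Suc n"] by (auto simp: T'_def prefix_of_Suc')
      then obtain n where "(s @ [b 0]) @ prefix_of (\<lambda>i. b (Suc i)) n \<in> D"
        using T[OF x] unfolding good_def by blast
      then have "s @ prefix_of b (Suc n) \<in> D" by (simp add: prefix_of_Suc')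
      then show ?thesis by blast
    qed
    ultimately have "good s T'" by (auto simp: good_def)
    then show ?thesis by (auto simp: G_def)
  qed
  show ?thesis
  proof (cases "[] \<in> G")
    case True
    then show ?thesis by (auto simp: G_def good_def)
  next
    case False
    have "{x. s @ [x] \<in> - G} \<in> p" if "s \<in> - G" for s
    proof -
      have "- {x. s @ [x] \<in> G} \<in> p" using step that ultrafilter_Compl[OF p] by blast
      moreover have "- {x. s @ [x] \<in> G} = {x. s @ [x] \<in> - G}" by auto
      ultimately show ?thesis by simp
    qed
    then have "ultratree p (- G)" using False by (simp add: ultratree_def)
    moreover have "- G \<inter> D = {}" using DG by blast
    ultimately show ?thesis by blast
  qed
qed

section \<open>Located words\<close>

text \<open>A located word is a partial map from positions to letters; the letter \<open>0\<close> is the variable.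
  Concatenation is \<open>(++)\<close>, which is associative also for words whose domains overlap.\<close>

interpretation map_add: semigroup "(++) :: ('a \<rightharpoonup> 'b) \<Rightarrow> _"
  by standard simp

definition subst :: "nat \<Rightarrow> ('a \<rightharpoonup> nat) \<Rightarrow> ('a \<rightharpoonup> nat)" where
  "subst a w = map_option (\<lambda>l. if l = 0 then a else l) \<circ> w"

lemma subst_add: "subst a (x ++ y) = subst a x ++ subst a y"
  by (auto simp: subst_def map_add_def fun_eq_iff split: option.split)

lemma dom_subst [simp]: "dom (subst a w) = dom w"
  by (auto simp: subst_def dom_def)

lemma subst_const: "0 \<notin> ran x \<Longrightarrow> subst a x = x"
  by (auto simp: subst_def ran_def fun_eq_iff map_option_case split: option.split)

text \<open>The letters \<open>1..k j\<close> are admissible at position \<open>j\<close>.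
  Monotonicity keeps a letter admissible at all later positions.\<close>

locale alphabets =
  fixes k :: "nat \<Rightarrow> nat"
  assumes k_pos: "1 \<le> k n" and k_mono: "mono k"
begin

definition word :: "nat \<Rightarrow> (nat \<rightharpoonup> nat) set" where
  "word N = {x. finite (dom x) \<and> dom x \<noteq> {} \<and> dom x \<subseteq> {N..} \<and> (\<forall>j l. x j = Some l \<longrightarrow> l \<le> k j)}"

definition cword :: "nat \<Rightarrow> (nat \<rightharpoonup> nat) set" where
  "cword N = {x \<in> word N. 0 \<notin> ran x}"

text \<open>The constant letter demanded besides the variable makes \<open>\<beta> n\<close> in the
  theorem a sum over a non-empty set.\<close>

definition vword :: "nat \<Rightarrow> (nat \<rightharpoonup> nat) set" where
  "vword N = {x \<in> word N. 0 \<in> ran x \<and> ran x - {0} \<noteq> {}}"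

lemma word_antimono: "M \<le> N \<Longrightarrow> word N \<subseteq> word M"
  by (fastforce simp: word_def)

lemma vword_antimono: "M \<le> N \<Longrightarrow> vword N \<subseteq> vword M"
  using word_antimono by (auto simp: vword_def)

lemma word_add: "x \<in> word N \<Longrightarrow> y \<in> word N \<Longrightarrow> x ++ y \<in> word N"
  by (auto simp: word_def map_add_Some_iff)

text \<open>For \<open>M\<close> beyond the domain of \<open>x\<close> the domains are disjoint;
  otherwise \<open>(++)\<close> could overwrite letters of \<open>x\<close> and so remove them from
  the range.\<close>

lemma word_bound:
  assumes "x \<in> word N"
  shows "\<exists>M\<ge>N. \<forall>y\<in>word M. x ++ y \<in> word N \<and> ran (x ++ y) = ran x \<union> ran y"
proof -
  obtain M where M: "dom x \<subseteq> {..<M}"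
    using assms unfolding word_def by (metis (lifting) mem_Collect_eq finite_nat_iff_bounded)
  have "x ++ y \<in> word N \<and> ran (x ++ y) = ran x \<union> ran y" if y: "y \<in> word (max M N)" for y
  proof
    show "x ++ y \<in> word N" using word_add[OF assms] y word_antimono[of N "max M N"] by auto
    have "dom x \<inter> dom y = {}" using M y by (fastforce simp: word_def)
    then show "ran (x ++ y) = ran x \<union> ran y" by (rule ran_map_add)
  qed
  then show ?thesis by (meson max.cobounded2)
qed

lemma subst_vword:
  assumes "w \<in> vword N" "1 \<le> a" "a \<le> k N"
  shows "subst a w \<in> cword N"
proof -
  have "l \<le> k j" if l: "subst a w j = Some l" for j l
  proof -
    obtain l' where l': "w j = Some l'" "l = (if l' = 0 then a else l')"
      using l by (auto simp: subst_def)
    have "N \<le> j" "l' \<le> k j" using l' assms by (auto simp: vword_def word_def)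
    then show ?thesis using l'(2) monoD[OF k_mono, of N j] assms(3) by auto
  qed
  moreover have "0 \<notin> ran (subst a w)" using assms(2) by (auto simp: subst_def ran_def)
  ultimately show ?thesis
    using assms(1) by (auto simp: vword_def cword_def word_def simp del: dom_eq_empty_conv)
qed

lemma vword_nonempty: "vword N \<noteq> {}"
proof -
  have "[N \<mapsto> 0, Suc N \<mapsto> 1] \<in> vword N"
    using k_pos by (auto simp: vword_def word_def)
  then show ?thesis by blast
qed

text \<open>The bound \<open>M\<close> may depend on \<open>x\<close>, since \<open>q\<close>
  contains every tail \<open>B M\<close>. The product rules for constant and variable words are
  instances.\<close>

lemma ultraprod_tails:
  assumes p: "p \<in> Stone_closed (range A)" and q: "q \<in> Stone_closed (range B)"
    and AB: "\<And>x N. x \<in> A N \<Longrightarrow> \<exists>M. \<forall>y\<in>B M. x ++ y \<in> C N"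
  shows "map_add.ultraprod p q \<in> Stone_closed (range C)"
proof -
  have up: "ultrafilter p" and uq: "ultrafilter q" using p q by (auto simp: Stone_closed_def)
  have "C N \<in> map_add.ultraprod p q" for N
  proof -
    obtain M where M: "\<And>x y. x \<in> A N \<Longrightarrow> y \<in> B (M x) \<Longrightarrow> x ++ y \<in> C N"
      using bchoice[of "A N" "\<lambda>x M. \<forall>y\<in>B M. x ++ y \<in> C N"] AB by blast
    show ?thesis
      by (rule map_add.ultraprodI[OF up uq, of "A N" "\<lambda>x. B (M x)"])
         (use p q M in \<open>auto simp: Stone_closed_def\<close>)
  qed
  then show ?thesis
    using map_add.ultraprod_ultrafilter[OF up uq] by (auto simp: Stone_closed_def)
qed

lemma ultraprod_cword_cword:
  assumes "p \<in> Stone_closed (range cword)" "q \<in> Stone_closed (range cword)"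
  shows "map_add.ultraprod p q \<in> Stone_closed (range cword)"
  by (rule ultraprod_tails[OF assms]) (use word_bound in \<open>fastforce simp: cword_def\<close>)

lemma ultraprod_cword_vword:
  assumes "p \<in> Stone_closed (range cword)" "q \<in> Stone_closed (range vword)"
  shows "map_add.ultraprod p q \<in> Stone_closed (range vword)"
  by (rule ultraprod_tails[OF assms]) (use word_bound in \<open>fastforce simp: cword_def vword_def\<close>)

lemma ultraprod_vword_cword:
  assumes "p \<in> Stone_closed (range vword)" "q \<in> Stone_closed (range cword)"
  shows "map_add.ultraprod p q \<in> Stone_closed (range vword)"
  by (rule ultraprod_tails[OF assms]) (use word_bound in \<open>fastforce simp: cword_def vword_def\<close>)

lemma ultraprod_vword_vword:
  assumes "p \<in> Stone_closed (range vword)" "q \<in> Stone_closed (range vword)"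
  shows "map_add.ultraprod p q \<in> Stone_closed (range vword)"
  by (rule ultraprod_tails[OF assms]) (use word_bound in \<open>fastforce simp: vword_def\<close>)

lemma ultrapower_cword:
  "p \<in> Stone_closed (range cword) \<Longrightarrow> map_add.ultrapower p n \<in> Stone_closed (range cword)"
  by (induction n) (auto intro: ultraprod_cword_cword)

lemma ultrapower_vword:
  "p \<in> Stone_closed (range vword) \<Longrightarrow> map_add.ultrapower p n \<in> Stone_closed (range vword)"
  by (induction n) (auto intro: ultraprod_vword_vword)

text \<open>Substitution fixes each constant word, and the set of constant words belongs to
  \<open>p\<close>.\<close>

lemma ultramap_subst_cword:
  assumes "p \<in> Stone_closed (range cword)"
  shows "ultramap (subst a) p = p"
proof -
  have p: "ultrafilter p" and c: "cword 0 \<in> p" using assms by (auto simp: Stone_closed_def)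
  have "A \<in> ultramap (subst a) p" if "A \<in> p" for A
  proof -
    have "A \<inter> cword 0 \<in> p" using that c p by (simp add: ultrafilter_Int)
    moreover have "A \<inter> cword 0 \<subseteq> {x. subst a x \<in> A}" by (auto simp: cword_def subst_const)
    ultimately show ?thesis unfolding mem_ultramap by (rule ultrafilter_mono[OF p])
  qed
  then show ?thesis
    using ultrafilter_eqI[OF p ultrafilter_ultramap[OF p]] by blast
qed

lemma ultramap_subst_vword:
  assumes "q \<in> Stone_closed (range vword)" "1 \<le> a" "a \<le> k N"
  shows "ultramap (subst a) q \<in> Stone_closed (range cword)"
proof -
  have q: "ultrafilter q" and v: "\<And>M. vword M \<in> q" using assms(1) by (auto simp: Stone_closed_def)
  have "cword M \<in> ultramap (subst a) q" for M
  proof -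
    have "subst a w \<in> cword M" if "w \<in> vword (max M N)" for w
    proof -
      have "a \<le> k (max M N)" using assms(3) monoD[OF k_mono, of N "max M N"] by simp
      then have "subst a w \<in> cword (max M N)" using subst_vword that assms(2) by blast
      then show ?thesis using word_antimono[of M "max M N"] by (auto simp: cword_def)
    qed
    then have "vword (max M N) \<subseteq> {w. subst a w \<in> cword M}" by blast
    then show ?thesis unfolding mem_ultramap by (rule ultrafilter_mono[OF q v])
  qed
  then show ?thesis using ultrafilter_ultramap[OF q] by (auto simp: Stone_closed_def)
qed

section \<open>The Hales--Jewett theorem for ultrafilters\<close>

text \<open>Colour focusing, with ultrafilters in place of words: among \<open>p'\<^sup>i p\<^sup>r\<^sup>-\<^sup>i\<close> for \<open>i \<le> r\<close>,
  two exponents \<open>i < j\<close> give the same colour, and \<open>p'\<^sup>i q\<^sup>j\<^sup>-\<^sup>i p\<^sup>r\<^sup>-\<^sup>j\<close> is the required ultrafilter.\<close>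

lemma Hales_Jewett_focus:
  assumes q: "q \<in> Stone_closed (range vword)" and m: "Suc m \<le> k N"
    and eq: "\<forall>a\<in>{1..m}. ultramap (subst a) q = ultramap (subst 1) q"
    and C: "finite C"
  shows "\<exists>q'\<in>Stone_closed (range vword). \<forall>a\<in>{1..Suc m}. \<forall>A\<in>C.
    A \<in> ultramap (subst a) q' \<longleftrightarrow> A \<in> ultramap (subst 1) q'"
proof -
  let ?pw = map_add.ultrapower and ?pr = map_add.ultraprod
  define p where "p = ultramap (subst 1) q"
  define p' where "p' = ultramap (subst (Suc m)) q"
  have p: "p \<in> Stone_closed (range cword)" "p' \<in> Stone_closed (range cword)"
    using ultramap_subst_vword[OF q, of _ N] m by (auto simp: p_def p'_def)
  define r where "r = card (Pow C)"
  define e where "e i = ?pr (?pw p' i) (?pw p (r - i))" for i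
  \<comment> \<open>There are \<open>r + 1\<close> exponents but at most \<open>r\<close> different
    colours \<open>e i \<inter> C\<close>.\<close>
  have "card ((\<lambda>i. e i \<inter> C) ` {0..r}) \<le> card (Pow C)"
    by (rule card_mono) (use C in auto)
  then have "\<not> inj_on (\<lambda>i. e i \<inter> C) {0..r}"
    by (intro pigeonhole) (simp add: r_def)
  then obtain i j where ij: "i < j" "j \<le> r" "e i \<inter> C = e j \<inter> C"
    unfolding inj_on_def by (metis atLeastAtMost_iff linorder_neqE_nat)
  \<comment> \<open>As \<open>ultrapower q d\<close> has \<open>d + 1\<close> factors, this
    \<open>d\<close> yields \<open>j - i\<close> of them.\<close>
  define d where "d = j - Suc i"
  have d: "j = i + Suc d" "r - i = d + Suc (r - j)" using ij by (auto simp: d_def)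
  define q' where "q' = ?pr (?pw p' i) (?pr (?pw q d) (?pw p (r - j)))"
  have q': "q' \<in> Stone_closed (range vword)"
    unfolding q'_def
    by (intro ultraprod_cword_vword ultraprod_vword_cword ultrapower_cword ultrapower_vword p q)
  have map: "ultramap (subst a) q' = ?pr (?pw p' i) (?pr (?pw (ultramap (subst a) q) d) (?pw p (r - j)))" for a
    using ultramap_subst_cword[OF ultrapower_cword[OF p(1)]]
      ultramap_subst_cword[OF ultrapower_cword[OF p(2)]]
    by (simp add: q'_def map_add.ultramap_ultraprod map_add.ultramap_ultrapower subst_add)
  \<comment> \<open>For \<open>a \<le> m\<close> the middle factors become \<open>p\<close> and join
    the power on the right; for \<open>a = Suc m\<close> they become \<open>p'\<close> and join the
    power on the left.\<close>
  have "ultramap (subst a) q' = e i" if "a \<in> {1..m}" for a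
    unfolding map e_def d(2) map_add.ultrapower_add bspec[OF eq that] p_def ..
  moreover have "ultramap (subst (Suc m)) q' = e j"
    unfolding map e_def d(1) map_add.ultrapower_add map_add.ultraprod_assoc p'_def ..
  ultimately have "ultramap (subst a) q' \<inter> C = e i \<inter> C" if "a \<in> {1..Suc m}" for a
    using that ij(3) by (cases "a = Suc m") auto
  then have "\<forall>a\<in>{1..Suc m}. ultramap (subst a) q' \<inter> C = ultramap (subst 1) q' \<inter> C" by simp
  then show ?thesis using q' by blast
qed

text \<open>Induction on the number of letters: \<open>Hales_Jewett_focus\<close> gives agreement on
  any finite family of sets, and compactness turns this into equality.\<close>

lemma Hales_Jewett:
  assumes "1 \<le> m" "m \<le> k N"
  shows "\<exists>q\<in>Stone_closed (range vword). \<forall>a\<in>{1..m}. ultramap (subst a) q = ultramap (subst 1) q"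
  using assms
proof (induction m rule: dec_induct)
  case base
  have "\<Inter>H \<noteq> {}" if H: "finite H" "H \<subseteq> range vword" for H
  proof -
    obtain I where I: "finite I" "H = vword ` I" using finite_subset_image[OF H] by blast
    have "vword (Max (insert 0 I)) \<subseteq> vword i" if "i \<in> I" for i
      by (rule vword_antimono) (use I that in simp)
    then have "vword (Max (insert 0 I)) \<subseteq> \<Inter>H" unfolding I(2) by blast
    then show ?thesis using vword_nonempty by blast
  qed
  then have "Stone_closed (range vword) \<noteq> {}" unfolding Stone_closed_nonempty_iff by simp
  then show ?case by auto
next
  case (step m)
  then obtain q where q: "q \<in> Stone_closed (range vword)"
    and eq: "\<forall>a\<in>{1..m}. ultramap (subst a) q = ultramap (subst 1) q"
    by (meson Suc_leD)
  \<comment> \<open>An ultrafilter contains \<open>Z A\<close> if and only if its images under the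
    substitutions of \<open>1..Suc m\<close> agree on \<open>A\<close>; containing every
    \<open>Z A\<close> thus means that these images are equal.\<close>
  define Z where "Z A = {w :: nat \<rightharpoonup> nat. \<forall>a\<in>{1..Suc m}. subst a w \<in> A \<longleftrightarrow> subst 1 w \<in> A}" for A
  have Z: "Z A \<in> q \<longleftrightarrow> (\<forall>a\<in>{1..Suc m}. A \<in> ultramap (subst a) q \<longleftrightarrow> A \<in> ultramap (subst 1) q)"
    if "ultrafilter q" for A q
    by (simp add: Z_def mem_ultramap ultrafilter_ball ultrafilter_iff that)
  have "Stone_closed (range vword \<union> range Z) \<noteq> {}"
    unfolding Stone_closed_nonempty_iff
  proof (intro allI impI)
    fix H assume H: "finite H" "H \<subseteq> range vword \<union> range Z"
    then have "finite (H - range vword)" "H - range vword \<subseteq> range Z" by auto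
    then obtain C where C: "finite C" "H - range vword = Z ` C" by (meson finite_subset_image)
    obtain q' where q': "q' \<in> Stone_closed (range vword)"
      and q'C: "\<forall>a\<in>{1..Suc m}. \<forall>A\<in>C. A \<in> ultramap (subst a) q' \<longleftrightarrow> A \<in> ultramap (subst 1) q'"
      using Hales_Jewett_focus[OF q step.prems eq C(1)] by (elim bexE)
    have "ultrafilter q'" using q' by (simp add: Stone_closed_def)
    then have "Z A \<in> q'" if "A \<in> C" for A
      using q'C that unfolding Z[OF \<open>ultrafilter q'\<close>] by blast
    then have "H - range vword \<subseteq> q'" unfolding C(2) image_subset_iff by blast
    moreover have "range vword \<subseteq> q'" using q' by (simp add: Stone_closed_def)
    ultimately have "H \<subseteq> q'" by (simp add: Diff_subset_conv sup.absorb2)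
    then show "\<Inter>H \<noteq> {}"
      using q' H(1) Stone_closed_nonempty_iff[of H] by (auto simp: Stone_closed_def)
  qed
  then obtain q where q: "ultrafilter q" "range vword \<subseteq> q" "range Z \<subseteq> q"
    by (auto simp: Stone_closed_def)
  then have "\<forall>a\<in>{1..Suc m}. ultramap (subst a) q = ultramap (subst 1) q"
    using Z[OF q(1)] by blast
  then show ?case using q by (auto simp: Stone_closed_def)
qed

section \<open>An idempotent ultrafilter of rich sets\<close>

definition rich :: "nat \<Rightarrow> (nat \<rightharpoonup> nat) set \<Rightarrow> bool" where
  "rich N A \<longleftrightarrow> (\<exists>w\<in>vword N. \<forall>a\<in>{1..k N}. subst a w \<in> A)"

text \<open>A larger \<open>N\<close> asks for more in two ways: the variable word starts later, and
  more letters are substituted.\<close>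

lemma rich_mono: "rich N A \<Longrightarrow> M \<le> N \<Longrightarrow> A \<subseteq> B \<Longrightarrow> rich M B"
  using vword_antimono[of M N] monoD[OF k_mono, of M N]
  unfolding rich_def by (meson atLeastAtMost_iff order_trans subsetD)

text \<open>The ultrafilters with only rich members form a closed set, non-empty by
  \<open>Hales_Jewett\<close>. It is closed under products because a constant word followed by a
  variable word is a variable word. Hence it contains an idempotent.\<close>

lemma rich_idempotent:
  "\<exists>p. ultrafilter p \<and> map_add.ultraprod p p = p \<and> (\<forall>A\<in>p. \<forall>N. rich N A)"
proof -
  define G where "G = {- A | A. \<exists>N. \<not> rich N A}"
  have mem: "p \<in> Stone_closed G \<longleftrightarrow> ultrafilter p \<and> (\<forall>A\<in>p. \<forall>N. rich N A)" for p
  proof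
    assume "p \<in> Stone_closed G"
    then have p: "ultrafilter p" "G \<subseteq> p" by (auto simp: Stone_closed_def)
    then have "- A \<in> p" if "\<not> rich N A" for A N using that by (auto simp: G_def)
    then show "ultrafilter p \<and> (\<forall>A\<in>p. \<forall>N. rich N A)" using p(1) ultrafilter_Compl by blast
  next
    assume "ultrafilter p \<and> (\<forall>A\<in>p. \<forall>N. rich N A)"
    then show "p \<in> Stone_closed G" using ultrafilter_Compl by (auto simp: Stone_closed_def G_def)
  qed
  have "Stone_closed G \<noteq> {}"
    unfolding Stone_closed_nonempty_iff
  proof (intro allI impI)
    fix H assume H: "finite H" "H \<subseteq> G"
    then have "\<forall>B\<in>H. \<exists>N. \<not> rich N (- B)" by (fastforce simp: G_def)
    then obtain n where n: "\<And>B. B \<in> H \<Longrightarrow> \<not> rich (n B) (- B)" by metis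
    \<comment> \<open>With \<open>N\<close> above all \<open>n B\<close>, a single \<open>q\<close>
      that identifies the letters up to \<open>k N\<close> serves all \<open>B\<close> in
      \<open>H\<close>.\<close>
    define N where "N = Max (insert 0 (n ` H))"
    obtain q where "q \<in> Stone_closed (range vword)"
      and eq: "\<forall>a\<in>{1..k N}. ultramap (subst a) q = ultramap (subst 1) q"
      using Hales_Jewett[OF k_pos order_refl, of N] by blast
    then have q: "ultrafilter q" "range vword \<subseteq> q" by (auto simp: Stone_closed_def)
    have u: "ultrafilter (ultramap (subst 1) q)" using q ultrafilter_ultramap by blast
    have "B \<in> ultramap (subst 1) q" if B: "B \<in> H" for B
    proof (rule ccontr)
      assume "B \<notin> ultramap (subst 1) q"
      then have "- B \<in> ultramap (subst 1) q" using u by (simp add: ultrafilter_Compl)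
      then have "- B \<in> ultramap (subst a) q" if "a \<in> {1..k N}" for a
        using bspec[OF eq that] by simp
      then have "{w. \<forall>a\<in>{1..k N}. subst a w \<in> - B} \<in> q"
        by (simp add: ultrafilter_ball[OF q(1)] mem_ultramap)
      then have "vword N \<inter> {w. \<forall>a\<in>{1..k N}. subst a w \<in> - B} \<in> q"
        using q by (auto simp: ultrafilter_Int)
      then have "rich N (- B)" using ultrafilter_nonempty[OF q(1)] by (fastforce simp: rich_def)
      moreover have "n B \<le> N" using H(1) B by (simp add: N_def)
      ultimately show False using n[OF B] rich_mono by blast
    qed
    then show "\<Inter>H \<noteq> {}"
      using u H(1) Stone_closed_nonempty_iff[of H] by (auto simp: Stone_closed_def)
  qed
  moreover have "map_add.ultraprod p q \<in> Stone_closed G"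
    if p: "p \<in> Stone_closed G" and q: "q \<in> Stone_closed G" for p q
  proof -
    have up: "ultrafilter p" and uq: "ultrafilter q" using p q by (auto simp: mem)
    have "rich N A" if A: "A \<in> map_add.ultraprod p q" for A N
    proof -
      \<comment> \<open>Instances of words of \<open>vword N\<close> with letters up to
        \<open>k N\<close> lie in \<open>cword N\<close>, so the complement of
        \<open>cword N\<close> is not in \<open>p\<close>.\<close>
      have "\<not> rich N (- cword N)" using subst_vword[of _ N 1] k_pos by (fastforce simp: rich_def)
      then have "cword N \<in> p" using p ultrafilter_Compl by (auto simp: mem)
      then have "cword N \<inter> {x. {y. x ++ y \<in> A} \<in> q} \<in> p"
        using A up by (simp add: ultrafilter_Int map_add.mem_ultraprod)
      then obtain x where x: "x \<in> cword N" "{y. x ++ y \<in> A} \<in> q"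
        using ultrafilter_nonempty[OF up] by blast
      then obtain M where M: "M \<ge> N"
        "\<And>y. y \<in> word M \<Longrightarrow> x ++ y \<in> word N \<and> ran (x ++ y) = ran x \<union> ran y"
        using word_bound[of x N] by (auto simp: cword_def)
      obtain w where w: "w \<in> vword M" "\<And>a. a \<in> {1..k M} \<Longrightarrow> x ++ subst a w \<in> A"
        using q x(2) unfolding mem rich_def by fastforce
      have "x ++ w \<in> vword N" using M(2) w(1) by (auto simp: vword_def)
      moreover have "subst a (x ++ w) \<in> A" if "a \<in> {1..k N}" for a
      proof -
        have "a \<in> {1..k M}" using that monoD[OF k_mono M(1)] by auto
        then show ?thesis using w(2) x(1) by (simp add: subst_add subst_const cword_def)
      qed
      ultimately show ?thesis unfolding rich_def by blast
    qed
    then show ?thesis using mem map_add.ultraprod_ultrafilter[OF up uq] by blast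
  qed
  ultimately show ?thesis
    using map_add.Stone_closed_idempotent[of G] mem by blast
qed

end

section \<open>Fusion\<close>

text \<open>The bound \<open>n\<close> cuts off a block that is still unfinished: at stage
  \<open>n\<close> of the fusion only the words with smaller index exist.\<close>

primrec cat :: "(nat \<Rightarrow> 'a \<rightharpoonup> 'b) \<Rightarrow> nat set \<Rightarrow> nat \<Rightarrow> ('a \<rightharpoonup> 'b)" where
  "cat v F 0 = Map.empty"
| "cat v F (Suc n) = (if n \<in> F then cat v F n ++ v n else cat v F n)"

lemma cat_empty: "F \<inter> {..<n} = {} \<Longrightarrow> cat v F n = Map.empty"
  by (induction n) (auto simp: lessThan_Suc)

lemma cat_bound:
  assumes "m \<le> n" "F \<subseteq> {..<m}"
  shows "cat v F n = cat v F m"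
  using assms by (induction n rule: dec_induct) auto

lemma block_sequence_less:
  assumes "block_sequence F" "i < j" "a \<in> F i" "b \<in> F j"
  shows "a < b"
proof -
  have step: "x < z" if "x \<in> F n" "z \<in> F (Suc n)" for n x z
  proof -
    have "x \<le> Max (F n)" "Min (F (Suc n)) \<le> z" "Max (F n) < Min (F (Suc n))"
      using assms(1) that by (auto simp: block_sequence_def)
    then show ?thesis by linarith
  qed
  have "\<forall>z\<in>F j. a < z"
    using assms(2)
  proof (induction j)
    case (Suc j)
    show ?case
    proof (cases "i = j")
      case True
      then show ?thesis using step assms(3) by blast
    next
      case False
      then have "\<forall>z\<in>F j. a < z" using Suc by simp
      moreover obtain c where "c \<in> F j" using assms(1) by (auto simp: block_sequence_def)
      ultimately show ?thesis using step[of c j] by (meson order_less_trans)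
    qed
  qed simp
  then show ?thesis using assms(4) by blast
qed

context alphabets
begin

text \<open>Members \<open>(s, x)\<close> of the state are sequences of finished blocks together with the current
  block, which may still grow.\<close>

definition extend :: "nat \<Rightarrow> (nat \<rightharpoonup> nat) \<Rightarrow> ((nat \<rightharpoonup> nat) list \<times> (nat \<rightharpoonup> nat)) set
    \<Rightarrow> ((nat \<rightharpoonup> nat) list \<times> (nat \<rightharpoonup> nat)) set" where
  "extend n w Z = Z \<union> (\<Union>a\<in>{1..k n}. insert ([], subst a w)
     ((\<lambda>(s, x). (s @ [x], subst a w)) ` Z \<union> (\<lambda>(s, x). (s, x ++ subst a w)) ` Z))"

lemma mem_extend:
  "(s, x) \<in> extend n w Z \<longleftrightarrow> (s, x) \<in> Z \<or> (\<exists>a\<in>{1..k n}. s = [] \<and> x = subst a w \<or>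
     (\<exists>t u. (t, u) \<in> Z \<and> s = t @ [u] \<and> x = subst a w) \<or> (\<exists>u. (s, u) \<in> Z \<and> x = u ++ subst a w))"
proof -
  have image: "c \<in> (\<lambda>(t, u). h t u) ` Z \<longleftrightarrow> (\<exists>t u. (t, u) \<in> Z \<and> c = h t u)"
    for h :: "(nat \<rightharpoonup> nat) list \<Rightarrow> (nat \<rightharpoonup> nat) \<Rightarrow> (nat \<rightharpoonup> nat) list \<times> (nat \<rightharpoonup> nat)" and c
    by force
  show ?thesis
    unfolding extend_def Un_iff UN_iff insert_iff image Pair_inject by blast
qed

text \<open>The invariant of the fusion. By the star set, the current block may be closed now, as
  \<open>s @ [x] \<in> T\<close>, and it may also grow by \<open>p\<close>-many words.\<close>

definition state :: "(nat \<rightharpoonup> nat) set set \<Rightarrow> (nat \<rightharpoonup> nat) list set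
    \<Rightarrow> ((nat \<rightharpoonup> nat) list \<times> (nat \<rightharpoonup> nat)) set \<Rightarrow> bool" where
  "state p T Z \<longleftrightarrow> finite Z \<and>
    (\<forall>(s, x)\<in>Z. s \<in> T \<and> x \<in> map_add.ultrastar p {x. s @ [x] \<in> T})"

text \<open>As \<open>Z\<close> is finite, the demands on a new word define one set \<open>C\<close>
  in \<open>p\<close>; richness of \<open>C\<close> gives a variable word whose instances meet them
  all.\<close>

lemma fusion_step:
  assumes p: "ultrafilter p" "map_add.ultraprod p p = p" "\<And>A N. A \<in> p \<Longrightarrow> rich N A"
    and T: "ultratree p T" and Z: "state p T Z" and nN: "n \<le> N"
  shows "\<exists>w\<in>vword N. state p T (extend n w Z)"
proof -
  let ?S = "\<lambda>s. map_add.ultrastar p {x. s @ [x] \<in> T}"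
  have S: "?S s \<in> p" if "s \<in> T" for s
    using T that by (intro map_add.ultrastar_mem p) (auto simp: ultratree_def)
  have Tx: "s @ [x] \<in> T" if "x \<in> ?S s" for s x
    using that by (simp add: map_add.ultrastar_def)
  have nil: "[] \<in> T" using T by (simp add: ultratree_def)
  \<comment> \<open>A new word must be able to open the first block, to prolong the current block of
    any member of \<open>Z\<close>, and to open the block after it.\<close>
  define C where "C = ?S [] \<inter> (\<Inter>(s, x)\<in>Z. {y. x ++ y \<in> ?S s} \<inter> ?S (s @ [x]))"
  have "(\<Inter>z\<in>Z. case z of (s, x) \<Rightarrow> {y. x ++ y \<in> ?S s} \<inter> ?S (s @ [x])) \<in> p"
  proof (rule ultrafilter_Inter[OF p(1)])
    show "finite Z" using Z by (simp add: state_def)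
    fix z assume "z \<in> Z"
    moreover obtain s x where z: "z = (s, x)" by (cases z)
    ultimately have x: "x \<in> ?S s" using Z by (auto simp: state_def)
    show "(case z of (s, x) \<Rightarrow> {y. x ++ y \<in> ?S s} \<inter> ?S (s @ [x])) \<in> p"
      using map_add.ultrastar_shift[OF p(1,2) x] S[OF Tx[OF x]] by (simp add: z ultrafilter_Int[OF p(1)])
  qed
  then have "C \<in> p" using S[OF nil] p(1) by (simp add: C_def ultrafilter_Int)
  then obtain w where w: "w \<in> vword N" "\<And>a. a \<in> {1..k N} \<Longrightarrow> subst a w \<in> C"
    using p(3)[of C N] unfolding rich_def by blast
  have wC: "subst a w \<in> C" if "a \<in> {1..k n}" for a
    using w(2) that monoD[OF k_mono nN] by auto
  have "finite (extend n w Z)" using Z by (auto simp: extend_def state_def)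
  moreover have "s \<in> T \<and> x \<in> ?S s" if sx: "(s, x) \<in> extend n w Z" for s x
  proof -
    consider "(s, x) \<in> Z" | a where "a \<in> {1..k n}" "s = []" "x = subst a w"
      | a t u where "a \<in> {1..k n}" "(t, u) \<in> Z" "s = t @ [u]" "x = subst a w"
      | a u where "a \<in> {1..k n}" "(s, u) \<in> Z" "x = u ++ subst a w"
      using sx unfolding mem_extend by blast
    then show ?thesis
    proof cases
      case 1
      then show ?thesis using Z by (auto simp: state_def)
    next
      case 2
      then show ?thesis using wC[OF 2(1)] nil by (simp add: C_def)
    next
      case 3
      have "u \<in> ?S t" using Z 3(2) by (auto simp: state_def)
      then show ?thesis using wC[OF 3(1)] Tx 3 by (auto simp: C_def)
    next
      case 4
      have "s \<in> T" using Z 4(2) by (auto simp: state_def)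
      then show ?thesis using wC[OF 4(1)] 4 by (auto simp: C_def)
    qed
  qed
  ultimately have "state p T (extend n w Z)" by (auto simp: state_def)
  then show ?thesis using w(1) by blast
qed

text \<open>The word with index \<open>n\<close> is skipped, prolongs block \<open>i\<close> or
  opens it, and \<open>extend\<close> provides for each of these cases.\<close>

lemma extend_cat:
  assumes Z: "\<And>n. Z (Suc n) = extend n (w n) (Z n)"
    and f: "\<And>n. 1 \<le> f n" "\<And>n. f n \<le> k n" and F: "block_sequence F"
    and ne: "F i \<inter> {..<n} \<noteq> {}"
  defines "v \<equiv> \<lambda>i. subst (f i) (w i)"
  shows "(prefix_of (\<lambda>j. cat v (F j) n) i, cat v (F i) n) \<in> Z n"
  using ne
proof (induction n arbitrary: i)
  case (Suc n)
  have fn: "f n \<in> {1..k n}" using f by simp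
  \<comment> \<open>Block \<open>i\<close> already has an index that is at most \<open>n\<close>, so
    all earlier blocks end before \<open>n\<close>.\<close>
  have cat_prev: "cat v (F j) (Suc n) = cat v (F j) n" if "j < i" for j
  proof -
    obtain b where "b \<in> F i" "b < Suc n" using Suc.prems by blast
    then have "n \<notin> F j" using block_sequence_less[OF F that, of n b] by auto
    then show ?thesis by simp
  qed
  then have pre: "prefix_of (\<lambda>j. cat v (F j) (Suc n)) i = prefix_of (\<lambda>j. cat v (F j) n) i"
    by (simp add: prefix_of_def)
  show ?case
  proof (cases "n \<in> F i")
    case False
    then have "F i \<inter> {..<n} \<noteq> {}" using Suc.prems by (auto simp: lessThan_Suc)
    then show ?thesis using Suc.IH[of i] False unfolding pre Z extend_def by simp
  next
    case n: True
    show ?thesis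
    proof (cases "F i \<inter> {..<n} = {}")
      case False
      have "(prefix_of (\<lambda>j. cat v (F j) n) i, cat v (F i) n ++ subst (f n) (w n)) \<in> Z (Suc n)"
        using Suc.IH[OF False] fn unfolding Z mem_extend by blast
      then show ?thesis using n unfolding pre by (simp add: v_def)
    next
      case True
      then have c: "cat v (F i) (Suc n) = subst (f n) (w n)"
        using n by (simp add: cat_empty v_def)
      show ?thesis
      proof (cases i)
        case 0
        then show ?thesis
          using fn unfolding pre c Z mem_extend by (auto simp: prefix_of_0)
      next
        case (Suc i')
        obtain b where b: "b \<in> F i'" using F by (auto simp: block_sequence_def)
        then have "b < n" using block_sequence_less[OF F _ b n] Suc by simp
        then have "F i' \<inter> {..<n} \<noteq> {}" using b by auto
        moreover have pre': "prefix_of (\<lambda>j. cat v (F j) n) i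
            = prefix_of (\<lambda>j. cat v (F j) n) i' @ [cat v (F i') n]"
          by (simp add: Suc prefix_of_Suc)
        ultimately show ?thesis
          using Suc.IH[of i'] fn unfolding pre' pre c Z mem_extend by blast
      qed
    qed
  qed
qed simp

lemma fusion:
  assumes p: "ultrafilter p" "map_add.ultraprod p p = p" "\<And>A N. A \<in> p \<Longrightarrow> rich N A"
    and T: "ultratree p T"
  shows "\<exists>w. block_sequence (\<lambda>n. dom (w n)) \<and> (\<forall>n. w n \<in> vword n) \<and>
    (\<forall>f F. (\<forall>n. 1 \<le> f n \<and> f n \<le> k n) \<longrightarrow> block_sequence F \<longrightarrow>
      (\<forall>i. prefix_of (\<lambda>i. cat (\<lambda>n. subst (f n) (w n)) (F i) (Suc (Max (F i)))) i \<in> T))"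
proof -
  \<comment> \<open>Dependent choice runs on pairs of a state and a bound \<open>N\<close> beyond
    the previous word. Taking the next word in \<open>vword N\<close> makes the domains consecutive,
    and \<open>n \<le> N\<close> puts it in \<open>vword n\<close>.\<close>
  define P where "P n = (\<lambda>(Z, N). state p T Z \<and> n \<le> N)" for n :: nat
  define Q where "Q n = (\<lambda>(Z, N) (Z', N'). \<exists>w\<in>vword N. dom w \<subseteq> {..<N'} \<and> Z' = extend n w Z)" for n
  have "\<exists>st. st 0 = ({}, 0) \<and> (\<forall>n. P n (st n) \<and> Q n (st n) (st (Suc n)))"
  proof -
    have "\<exists>st. \<forall>n. (P n (st n) \<and> (n = 0 \<longrightarrow> st n = ({}, 0))) \<and> Q n (st n) (st (Suc n))"
    proof (rule dependent_nat_choice)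
      show "\<exists>x. P 0 x \<and> (0 = (0::nat) \<longrightarrow> x = ({}, 0))" by (auto simp: P_def state_def)
      fix st n assume "P n st \<and> (n = 0 \<longrightarrow> st = ({}, 0))"
      then obtain Z N where st: "st = (Z, N)" "state p T Z" "n \<le> N" by (cases st) (auto simp: P_def)
      obtain w where w: "w \<in> vword N" "state p T (extend n w Z)"
        using fusion_step[OF p T] st(2,3) by blast
      obtain N' where N': "dom w \<subseteq> {..<N'}"
        using w(1) finite_nat_bounded[of "dom w"] by (auto simp: vword_def word_def)
      have "P (Suc n) (extend n w Z, max N' (Suc n)) \<and> (Suc n = 0 \<longrightarrow> (extend n w Z, max N' (Suc n)) = ({}, 0))"
        using w by (simp add: P_def)
      moreover have "dom w \<subseteq> {..<max N' (Suc n)}" using N' by auto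
      then have "Q n st (extend n w Z, max N' (Suc n))"
        using w(1) unfolding Q_def st(1) prod.case by blast
      ultimately show "\<exists>y. (P (Suc n) y \<and> (Suc n = 0 \<longrightarrow> y = ({}, 0))) \<and> Q n st y" by blast
    qed
    then show ?thesis by blast
  qed
  then obtain st where st: "st 0 = ({}, 0)" "\<And>n. P n (st n)" "\<And>n. Q n (st n) (st (Suc n))"
    by blast
  define Z where "Z n = fst (st n)" for n
  define N where "N n = snd (st n)" for n
  have ZT: "state p T (Z n)" and nN: "n \<le> N n" for n
    using st(2)[of n] by (auto simp: P_def Z_def N_def split: prod.splits)
  have "\<exists>w. w \<in> vword (N n) \<and> dom w \<subseteq> {..<N (Suc n)} \<and> Z (Suc n) = extend n w (Z n)" for n
    using st(3)[of n] by (auto simp: Q_def Z_def N_def split: prod.splits)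
  then obtain w where w: "\<And>n. w n \<in> vword (N n)" "\<And>n. dom (w n) \<subseteq> {..<N (Suc n)}"
    and Z: "\<And>n. Z (Suc n) = extend n (w n) (Z n)" by metis
  have dom: "finite (dom (w n)) \<and> dom (w n) \<noteq> {} \<and> dom (w n) \<subseteq> {N n..}" for n
    using w(1)[of n] by (simp add: vword_def word_def)
  have "Max (dom (w n)) < Min (dom (w (Suc n)))" for n
  proof -
    have "Max (dom (w n)) \<in> dom (w n)" "Min (dom (w (Suc n))) \<in> dom (w (Suc n))"
      using dom by simp_all
    then show ?thesis using w(2)[of n] dom[of "Suc n"] by fastforce
  qed
  then have "block_sequence (\<lambda>n. dom (w n))" using dom by (simp add: block_sequence_def)
  moreover have "w n \<in> vword n" for n using w(1) vword_antimono[OF nN] by blast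
  moreover have "prefix_of (\<lambda>i. cat (\<lambda>n. subst (f n) (w n)) (F i) (Suc (Max (F i)))) i \<in> T"
    if f: "\<And>n. 1 \<le> f n \<and> f n \<le> k n" and F: "block_sequence F" for f F i
  proof (cases i)
    case 0
    then show ?thesis using T by (simp add: prefix_of_0 ultratree_def)
  next
    case (Suc i')
    \<comment> \<open>Stage \<open>?n\<close> comes right after the last index of block
      \<open>i'\<close>. This block is complete there, and the invariant allows closing it inside
      \<open>T\<close>.\<close>
    let ?v = "\<lambda>n. subst (f n) (w n)" and ?n = "Suc (Max (F i'))"
    have fin: "finite (F j)" "F j \<noteq> {}" for j using F by (auto simp: block_sequence_def)
    have "Max (F i') \<in> F i' \<inter> {..<?n}" using fin[of i'] by simp
    then have "(prefix_of (\<lambda>j. cat ?v (F j) ?n) i', cat ?v (F i') ?n) \<in> Z ?n"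
      using extend_cat[where Z=Z and w=w and f=f and F=F, OF Z _ _ F] f by blast
    then have "prefix_of (\<lambda>j. cat ?v (F j) ?n) i' @ [cat ?v (F i') ?n] \<in> T"
      using ZT[of ?n] by (auto simp: state_def map_add.ultrastar_def)
    \<comment> \<open>Earlier blocks end before block \<open>i'\<close> does, so the cut at
      \<open>?n\<close> omits nothing of them.\<close>
    moreover have "cat ?v (F j) ?n = cat ?v (F j) (Suc (Max (F j)))" if "j < i'" for j
    proof (rule cat_bound)
      show "F j \<subseteq> {..<Suc (Max (F j))}" using fin by (simp add: subset_iff less_Suc_eq_le)
      show "Suc (Max (F j)) \<le> ?n"
        using block_sequence_less[OF F that Max_in Max_in] fin by (simp add: less_imp_le)
    qed
    then have "prefix_of (\<lambda>j. cat ?v (F j) ?n) i' = prefix_of (\<lambda>j. cat ?v (F j) (Suc (Max (F j)))) i'"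
      unfolding prefix_of_def by (intro map_cong) auto
    ultimately show ?thesis unfolding Suc prefix_of_Suc by simp
  qed
  ultimately show ?thesis by blast
qed

end

section \<open>Evaluation in a commutative semigroup\<close>

lemma semigroup_sum_cong:
  assumes "finite F" "F \<noteq> {}" "\<And>n. n \<in> F \<Longrightarrow> x n = z n"
  shows "semigroup_sum x F = semigroup_sum z F"
  using assms by (induction rule: finite_ne_induct) (auto simp: semigroup_sum_singleton semigroup_sum_insert)

lemma semigroup_sum_Un:
  assumes "finite A" "A \<noteq> {}" "finite B" "B \<noteq> {}" "A \<inter> B = {}"
  shows "semigroup_sum x (A \<union> B) = semigroup_sum x A + semigroup_sum x B"
  using assms by (induction rule: finite_ne_induct)
    (auto simp: semigroup_sum_singleton semigroup_sum_insert add.assoc)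

definition word_value :: "(nat \<Rightarrow> nat \<Rightarrow> 'a::ab_semigroup_add) \<Rightarrow> (nat \<rightharpoonup> nat) \<Rightarrow> 'a" where
  "word_value y x = semigroup_sum (\<lambda>j. y (the (x j)) j) (dom x)"

lemma word_value_add:
  assumes "finite (dom x)" "dom x \<noteq> {}" "finite (dom z)" "dom z \<noteq> {}" "dom x \<inter> dom z = {}"
  shows "word_value y (x ++ z) = word_value y x + word_value y z"
proof -
  have "word_value y (x ++ z) = semigroup_sum (\<lambda>j. y (the ((x ++ z) j)) j) (dom x \<union> dom z)"
    by (simp add: word_value_def Un_commute)
  also have "\<dots> = semigroup_sum (\<lambda>j. y (the ((x ++ z) j)) j) (dom x)
      + semigroup_sum (\<lambda>j. y (the ((x ++ z) j)) j) (dom z)"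
    by (rule semigroup_sum_Un[OF assms])
  also have "semigroup_sum (\<lambda>j. y (the ((x ++ z) j)) j) (dom x) = word_value y x"
    unfolding word_value_def using assms
    by (intro semigroup_sum_cong) (auto simp: map_add_def split: option.split)
  also have "semigroup_sum (\<lambda>j. y (the ((x ++ z) j)) j) (dom z) = word_value y z"
    unfolding word_value_def using assms
    by (intro semigroup_sum_cong) (auto simp: map_add_def split: option.split)
  finally show ?thesis .
qed

text \<open>The claim on domains is carried through the induction to show that the next word
  occupies fresh positions, as \<open>word_value_add\<close> requires.\<close>

lemma word_value_cat:
  assumes v: "block_sequence (\<lambda>i. dom (v i))" and "F \<inter> {..<n} \<noteq> {}"
  shows "word_value y (cat v F n) = semigroup_sum (\<lambda>i. word_value y (v i)) (F \<inter> {..<n})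
    \<and> dom (cat v F n) = (\<Union>i\<in>F \<inter> {..<n}. dom (v i))"
  using assms(2)
proof (induction n)
  case (Suc n)
  have fin: "finite (dom (v i))" "dom (v i) \<noteq> {}" for i using v by (auto simp: block_sequence_def)
  show ?case
  proof (cases "n \<in> F")
    case False
    then have "F \<inter> {..<Suc n} = F \<inter> {..<n}" by (auto simp: lessThan_Suc)
    then show ?thesis using Suc False by simp
  next
    case n: True
    then have eq: "F \<inter> {..<Suc n} = insert n (F \<inter> {..<n})" by (auto simp: lessThan_Suc)
    show ?thesis
    proof (cases "F \<inter> {..<n} = {}")
      case True
      then have "cat v F n = Map.empty" by (rule cat_empty)
      then show ?thesis unfolding eq True using n by (simp add: semigroup_sum_singleton)
    next
      case False
      have val: "word_value y (cat v F n) = semigroup_sum (\<lambda>i. word_value y (v i)) (F \<inter> {..<n})"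
        and dom: "dom (cat v F n) = (\<Union>i\<in>F \<inter> {..<n}. dom (v i))" using Suc.IH[OF False] by auto
      have "dom (v i) \<inter> dom (v n) = {}" if "i < n" for i
        using block_sequence_less[OF v that] by blast
      then have "dom (cat v F n) \<inter> dom (v n) = {}" unfolding dom by blast
      moreover have "finite (dom (cat v F n))" "dom (cat v F n) \<noteq> {}"
        unfolding dom using fin False by auto
      ultimately have "word_value y (cat v F n ++ v n) = word_value y (cat v F n) + word_value y (v n)"
        using fin by (intro word_value_add) auto
      also have "\<dots> = semigroup_sum (\<lambda>i. word_value y (v i)) (insert n (F \<inter> {..<n}))"
        using False by (subst semigroup_sum_insert) (auto simp: val add.commute)
      finally show ?thesis using n unfolding eq by (auto simp: dom)
    qed
  qed
qed simp

text \<open>A basic open set of the product topology restricts only finitely many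
  coordinates.\<close>

lemma closedin_pointwise_prefix:
  assumes U: "closedin pointwise_topology U" and g: "g \<notin> U"
  shows "\<exists>n. \<forall>g'. (\<forall>i<n. g' i = g i) \<longrightarrow> g' \<notin> U"
proof -
  have "openin pointwise_topology (UNIV - U)"
    using U by (simp add: closedin_def topspace_product_topology)
  then obtain V where V: "finite {i \<in> UNIV. V i \<noteq> topspace (discrete_topology UNIV)}"
    "g \<in> Pi\<^sub>E UNIV V" "Pi\<^sub>E UNIV V \<subseteq> UNIV - U"
    using g unfolding openin_product_topology_alt by blast
  obtain n where n: "{i. V i \<noteq> UNIV} \<subseteq> {..<n}"
    using V(1) finite_nat_bounded by auto
  have "g' \<notin> U" if "\<forall>i<n. g' i = g i" for g'
  proof -
    have "g' i \<in> V i" for i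
      using that n V(2) by (cases "i < n") (auto simp: PiE_iff)
    then show ?thesis using V(3) by (auto simp: PiE_iff)
  qed
  then show ?thesis by blast
qed

text \<open>Sequences are indexed from \<open>0\<close>. The clause
  \<open>E n - H n \<noteq> {}\<close> gives \<open>\<beta> n\<close> its meaning, as a semigroup
  has no empty sum.\<close>

theorem theorem3p18:
  fixes k :: "nat \<Rightarrow> nat"
    and y :: "nat \<Rightarrow> nat \<Rightarrow> 'a::ab_semigroup_add"
    and U :: "(nat \<Rightarrow> 'a) set"
  assumes "\<And>n. 1 \<le> k n"
    and "mono k"
    and "closedin pointwise_topology U"
  shows "\<exists>(E :: nat \<Rightarrow> nat set) (H :: nat \<Rightarrow> nat set) (\<beta> :: nat \<Rightarrow> 'a).
    block_sequence E
    \<and> (\<forall>n. H n \<noteq> {} \<and> H n \<subseteq> E n \<and> E n - H n \<noteq> {})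
    \<and> (\<forall>n. \<exists>l :: nat \<Rightarrow> nat. (\<forall>j \<in> E n - H n. 1 \<le> l j \<and> l j \<le> k j)
           \<and> \<beta> n = semigroup_sum (\<lambda>j. y (l j) j) (E n - H n))
    \<and> (\<forall>f :: nat \<Rightarrow> nat. (\<forall>n. 1 \<le> f n \<and> f n \<le> k n) \<longrightarrow>
          FS_omega (\<lambda>n. \<beta> n + semigroup_sum (\<lambda>t. y (f n) t) (H n)) \<subseteq> U
        \<or> FS_omega (\<lambda>n. \<beta> n + semigroup_sum (\<lambda>t. y (f n) t) (H n)) \<subseteq> UNIV - U)"
proof -
  interpret alphabets k by standard (use assms in auto)
  \<comment> \<open>\<open>D\<close> consists of the finite sequences of words whose values already
    force a sequence out of \<open>U\<close>.\<close>
  define D where "D = {s. \<forall>g. (\<forall>i<length s. g i = word_value y (s ! i)) \<longrightarrow> g \<notin> U}"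
  obtain p where p: "ultrafilter p" "map_add.ultraprod p p = p" "\<And>A N. A \<in> p \<Longrightarrow> rich N A"
    using rich_idempotent by blast
  obtain T where T: "ultratree p T"
    and dich: "T \<inter> D = {} \<or> (\<forall>b. (\<forall>n. prefix_of b n \<in> T) \<longrightarrow> (\<exists>n. prefix_of b n \<in> D))"
    using ultratree_dichotomy[OF p(1)] by blast
  obtain w where blocks: "block_sequence (\<lambda>n. dom (w n))" and wv: "\<And>n. w n \<in> vword n"
    and wT: "\<And>f F i. \<forall>n. 1 \<le> f n \<and> f n \<le> k n \<Longrightarrow> block_sequence F \<Longrightarrow>
      prefix_of (\<lambda>i. cat (\<lambda>n. subst (f n) (w n)) (F i) (Suc (Max (F i)))) i \<in> T"
    using fusion[OF p T] by blast
  \<comment> \<open>With \<open>E n\<close> the domain of \<open>w n\<close>, the set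
    \<open>H n\<close> holds the positions of the variable, and the constant letters of
    \<open>w n\<close> serve as the indices \<open>l j\<close>.\<close>
  define H where "H n = {j. w n j = Some 0}" for n
  define \<beta> where "\<beta> n = semigroup_sum (\<lambda>j. y (the (w n j)) j) (dom (w n) - H n)" for n
  have fin: "finite (dom (w n))" for n using blocks by (simp add: block_sequence_def)
  have H: "H n \<noteq> {} \<and> H n \<subseteq> dom (w n) \<and> dom (w n) - H n \<noteq> {}" for n
    using wv[of n] by (auto simp: vword_def H_def ran_def)
  have letters: "1 \<le> the (w n j) \<and> the (w n j) \<le> k j" if "j \<in> dom (w n) - H n" for n j
    using wv[of n] that by (auto simp: vword_def word_def H_def)
  have val: "\<beta> n + semigroup_sum (y a) (H n) = word_value y (subst a (w n))" for a n
  proof -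
    let ?s = "subst a (w n)"
    have "\<beta> n = semigroup_sum (\<lambda>j. y (the (?s j)) j) (dom (w n) - H n)"
      unfolding \<beta>_def using H fin
      by (intro semigroup_sum_cong) (auto simp: subst_def H_def)
    moreover have "semigroup_sum (y a) (H n) = semigroup_sum (\<lambda>j. y (the (?s j)) j) (H n)"
      using H finite_subset[OF _ fin[of n]]
      by (intro semigroup_sum_cong) (auto simp: subst_def H_def)
    moreover have "semigroup_sum (\<lambda>j. y (the (?s j)) j) ((dom (w n) - H n) \<union> H n)
        = semigroup_sum (\<lambda>j. y (the (?s j)) j) (dom (w n) - H n)
          + semigroup_sum (\<lambda>j. y (the (?s j)) j) (H n)"
      using H fin[of n] finite_subset[OF _ fin[of n]] by (intro semigroup_sum_Un) blast+
    moreover have "(dom (w n) - H n) \<union> H n = dom (w n)" using H by blast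
    ultimately show ?thesis by (simp add: word_value_def)
  qed
  have homogeneous: "FS_omega (\<lambda>n. \<beta> n + semigroup_sum (\<lambda>t. y (f n) t) (H n)) \<subseteq> U
      \<or> FS_omega (\<lambda>n. \<beta> n + semigroup_sum (\<lambda>t. y (f n) t) (H n)) \<subseteq> UNIV - U"
    if f: "\<forall>n. 1 \<le> f n \<and> f n \<le> k n" for f
  proof -
    \<comment> \<open>Summing the generators over \<open>F i\<close> evaluates the concatenation of
      the instances with index in \<open>F i\<close>, and these concatenations form a branch of
      \<open>T\<close>.\<close>
    have branch: "\<exists>b. g = (\<lambda>i. word_value y (b i)) \<and> (\<forall>n. prefix_of b n \<in> T)"
      if g: "g \<in> FS_omega (\<lambda>n. \<beta> n + semigroup_sum (\<lambda>t. y (f n) t) (H n))" for g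
    proof -
      let ?v = "\<lambda>n. subst (f n) (w n)"
      obtain F where F: "block_sequence F" "\<And>n. g n = semigroup_sum (\<lambda>n. word_value y (?v n)) (F n)"
        using g by (auto simp: FS_omega_def val)
      define b where "b = (\<lambda>i. cat ?v (F i) (Suc (Max (F i))))"
      have "word_value y (b i) = g i" for i
      proof -
        have "F i \<inter> {..<Suc (Max (F i))} = F i" "F i \<noteq> {}"
          using F(1) by (auto simp: block_sequence_def less_Suc_eq_le)
        then show ?thesis
          using word_value_cat[of ?v "F i" "Suc (Max (F i))" y] blocks F(2)[of i]
          by (simp add: b_def)
      qed
      moreover have "prefix_of b n \<in> T" for n unfolding b_def by (rule wT[OF f F(1)])
      ultimately show ?thesis by (intro exI[of _ b]) (simp add: fun_eq_iff)
    qed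
    show ?thesis
    proof (cases "T \<inter> D = {}")
      case True
      \<comment> \<open>As \<open>U\<close> is closed, a sequence outside \<open>U\<close> is forced
        out by some prefix, but no node of \<open>T\<close> is in \<open>D\<close>.\<close>
      have "g \<in> U" if "g = (\<lambda>i. word_value y (b i))" "\<And>n. prefix_of b n \<in> T" for g b
      proof (rule ccontr)
        assume "g \<notin> U"
        then obtain n where "\<And>g'. \<forall>i<n. g' i = g i \<Longrightarrow> g' \<notin> U"
          using closedin_pointwise_prefix[OF assms(3)] by blast
        then have "prefix_of b n \<in> D" by (simp add: D_def prefix_of_def that(1))
        then show False using True that(2) by blast
      qed
      then show ?thesis using branch by blast
    next
      case False
      have "g \<notin> U" if gb: "g = (\<lambda>i. word_value y (b i))" "\<And>n. prefix_of b n \<in> T" for g b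
      proof -
        obtain n where "prefix_of b n \<in> D" using dich False gb(2) by blast
        then show ?thesis by (auto simp: D_def prefix_of_def gb(1))
      qed
      then show ?thesis using branch by blast
    qed
  qed
  have fixed: "\<exists>l :: nat \<Rightarrow> nat. (\<forall>j \<in> dom (w n) - H n. 1 \<le> l j \<and> l j \<le> k j)
      \<and> \<beta> n = semigroup_sum (\<lambda>j. y (l j) j) (dom (w n) - H n)" for n
    using letters by (intro exI[of _ "\<lambda>j. the (w n j)"]) (simp add: \<beta>_def)
  show ?thesis
    by (rule exI[of _ "\<lambda>n. dom (w n)"], rule exI[of _ H], rule exI[of _ \<beta>])
      (intro conjI[OF blocks] conjI allI impI fixed homogeneous; (use H in blast)?)
qed

end
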